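(* Yamada semigroups are isomorphic to Morita semigroups: if $S=\mathscr{Y}(X,T,Y)$ is a Yamada semigroup, then $S$ is isomorphic, as a semigroup, to the Morita semigroup $S_L\otimes S_R$ over $S/\gamma$ defined by the bilinear map $\langle\,,\,\rangle\colon S_R\times S_L\to S/\gamma$.
   Context: Inverse semigroups. For an inverse semigroup $T$, $E(T)$ is its meet semilattice of idempotents, $\mathbf{d}(t)=t^{-1}t$ and $\mathbf{r}(t)=tt^{-1}$. Presheaves. A presheaf of sets over a meet semilattice $E$ consists of pairwise disjoint sets $X_e$ ($e\in E$) and restriction functions $X_e\to X_f$, $x\mapsto x|^e_f$, for $e\ge f$, such that $|^e_e$ is the identity and $(x|^e_f)|^f_g=x|^e_g$ for $e\ge f\ge g$. Put $X=\bigcup_e X_e$ and $p(x)=e$ if $x\in X_e$. It has global support if all $X_e$ are non-empty. Such a presheaf gives a left action of $E$ on $X$ by $e\cdot x=x|^{p(x)}_{e\wedge p(x)}$, or equally a right action $x\cdot e=x|^{p(x)}_{e\wedge p(x)}$. Yamada semigroups. Let $T$ be an inverse semigroup and let $(X,p)$, $(Y,q)$ be presheaves of sets over $E(T)$ with global support, with $E(T)$ acting on the right on $X$ by $x\cdot e=x|^{p(x)}_{e\wedge p(x)}$ and on the left on $Y$ by $e\cdot y=y|^{q(y)}_{e\wedge q(y)}$. The Yamada semigroup $\mathscr{Y}(X,T,Y)$ is the set $\{(x,t,y)\in X\times T\times Y: p(x)=\mathbf{r}(t),\ q(y)=\mathbf{d}(t)\}$ with product $(x,s,y)(u,t,v)=(x\cdot\mathbf{r}(st),\,st,\,\mathbf{d}(st)\cdot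 v)$. By a theorem of Yamada, it is a generalized inverse semigroup, i.e. a regular semigroup whose idempotents form a normal band (a band satisfying $efgh=egfh$), and every generalized inverse semigroup is isomorphic to one of this form. Congruences. For a generalized inverse semigroup $S$, let $V(s)$ be the set of inverses of $s$ (elements $t$ with $s=sts$, $t=tst$). Then $s\,\gamma\,t\Leftrightarrow V(s)\cap V(t)\neq\emptyset$ is the minimum inverse congruence on $S$. Put $\lambda=\gamma\cap\mathscr{L}$ and $\rho=\gamma\cap\mathscr{R}$, where $\mathscr{L},\mathscr{R}$ are Green's relations; these are congruences on $S$. Write $\gamma(s),\lambda(s),\rho(s)$ for the classes of $s$. Put $S_R=S/\lambda$ and $S_L=S/\rho$. Then $S_R$ is a left $S/\gamma$-set via $\gamma(a)\cdot\lambda(s)=\lambda(as)$, and $S_L$ is a right $S/\gamma$-set via $\rho(s)\cdot\gamma(a)=\rho(sa)$ (these actions are well defined). Morita semigroups. The tensor product $S_L\otimes S_R$ over $S/\gamma$ is the quotient of the set $S_L\times S_R$ by the equivalence relation generated by identifying $(q\cdot r,p)$ with $(q,r\cdot p)$ for $q\in S_L$, $p\in S_R$, $r\in S/\gamma$; the class of $(q,p)$ is written $q\otimes p$. Define $\langle\,,\,\rangle\colon S_R\times S_L\to S/\gamma$ by $\langle\lambda(s),\rho(t)\rangle=\gamma(st)$. It is bilinear: $\langle r\cdot p,q\rangle=r\langle p,q\rangle$ and $\langle p,q\cdot r\rangle=\langle p,q\rangle r$. Hence $S_L\otimes S_R$ is a semigroup under $(q\otimes p)(q'\otimes p')=q\otimes\langle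 p,q'\rangle\cdot p'$; this is called the Morita semigroup over $S/\gamma$ defined by $\langle\,,\,\rangle$. *)

theory Defs
  imports "HOL-Algebra.Complete_Lattice"
begin

record 'a magma = "'a partial_object" +
  mul :: "'a \<Rightarrow> 'a \<Rightarrow> 'a" (infixl \<open>\<odot>\<index>\<close> 70)

locale sgroup =
  fixes S (structure)
  assumes mul_closed: "\<lbrakk>a \<in> carrier S; b \<in> carrier S\<rbrakk> \<Longrightarrow> a \<odot> b \<in> carrier S"
    and mul_assoc: "\<lbrakk>a \<in> carrier S; b \<in> carrier S; c \<in> carrier S\<rbrakk>
      \<Longrightarrow> (a \<odot> b) \<odot> c = a \<odot> (b \<odot> c)"

definition sgroup_isomorphic :: "'a magma \<Rightarrow> 'b magma \<Rightarrow> bool"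
  where "sgroup_isomorphic A B \<longleftrightarrow> sgroup A \<and> sgroup B \<and>
    (\<exists>h. bij_betw h (carrier A) (carrier B) \<and>
      (\<forall>a\<in>carrier A. \<forall>b\<in>carrier A. h (a \<odot>\<^bsub>A\<^esub> b) = h a \<odot>\<^bsub>B\<^esub> h b))"

definition inverses :: "'a magma \<Rightarrow> 'a \<Rightarrow> 'a set"
  where "inverses S s = {t \<in> carrier S. s = s \<odot>\<^bsub>S\<^esub> t \<odot>\<^bsub>S\<^esub> s \<and> t = t \<odot>\<^bsub>S\<^esub> s \<odot>\<^bsub>S\<^esub> t}"

locale inverse_sgroup = sgroup T for T :: "'t magma" (structure) +
  assumes unique_inverse: "s \<in> carrier T \<Longrightarrow> \<exists>!t. t \<in> inverses T s"

definition sinv :: "'t magma \<Rightarrow> 't \<Rightarrow> 't"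
  where "sinv T t = (THE u. u \<in> inverses T t)"

definition sdom :: "'t magma \<Rightarrow> 't \<Rightarrow> 't"
  where "sdom T t = sinv T t \<odot>\<^bsub>T\<^esub> t"

definition sran :: "'t magma \<Rightarrow> 't \<Rightarrow> 't"
  where "sran T t = t \<odot>\<^bsub>T\<^esub> sinv T t"

text \<open>The idempotents under the natural partial order; for an inverse semigroup this is a
  meet semilattice in which the meet is the product.\<close>

definition idems :: "'t magma \<Rightarrow> 't gorder"
  where "idems T = \<lparr>carrier = {e \<in> carrier T. e \<odot>\<^bsub>T\<^esub> e = e}, eq = (=),
    le = (\<lambda>e f. e = e \<odot>\<^bsub>T\<^esub> f)\<rparr>"

lemma (in inverse_sgroup) inverse_unique:
  assumes "s \<in> carrier T" "t \<in> inverses T s" "u \<in> inverses T s"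
  shows "t = u"
  using unique_inverse[OF assms(1)] assms(2,3) by blast

lemma (in inverse_sgroup) idem_mul_idem:
  assumes e: "e \<in> carrier T" "e \<odot> e = e" and f: "f \<in> carrier T" "f \<odot> f = f"
  shows "(e \<odot> f) \<odot> (e \<odot> f) = e \<odot> f"
proof -
  have ef: "e \<odot> f \<in> carrier T" using e f by (simp add: mul_closed)
  obtain x where x: "x \<in> inverses T (e \<odot> f)" using unique_inverse[OF ef] by blast
  then have xc: "x \<in> carrier T" and x1: "e \<odot> f \<odot> x \<odot> (e \<odot> f) = e \<odot> f"
    and x2: "x \<odot> (e \<odot> f) \<odot> x = x"
    by (auto simp: inverses_def)
  note [simp] = mul_assoc mul_closed
  have ee: "e \<odot> (e \<odot> z) = e \<odot> z" and ff: "f \<odot> (f \<odot> z) = f \<odot> z" if "z \<in> carrier T" for z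
    using that e f by (metis mul_assoc)+
  have x1': "e \<odot> (f \<odot> (x \<odot> (e \<odot> f))) = e \<odot> f" and x2': "x \<odot> (e \<odot> (f \<odot> x)) = x"
    using x1 x2 xc e f by simp_all
  have x2'': "x \<odot> (e \<odot> (f \<odot> (x \<odot> z))) = x \<odot> z" if "z \<in> carrier T" for z
  proof -
    have "x \<odot> (e \<odot> (f \<odot> (x \<odot> z))) = (x \<odot> (e \<odot> (f \<odot> x))) \<odot> z"
      using that xc e(1) f(1) by simp
    then show ?thesis using x2' by simp
  qed
  define y where "y = f \<odot> x \<odot> e"
  have yc: "y \<in> carrier T" using xc e f by (simp add: y_def)
  have "y \<in> inverses T (e \<odot> f)"
    using xc e f x1' x2'' by (simp add: y_def inverses_def ee ff)
  then have xy: "x = y" using inverse_unique[OF ef x] by blast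
  have "y \<odot> y = y" using xc e f x2'' by (simp add: y_def)
  then have xx: "x \<odot> x = x" using xy by simp
  have "x \<in> inverses T x" using xc xx by (simp add: inverses_def)
  moreover have "e \<odot> f \<in> inverses T x" using ef xc x1 x2 by (auto simp: inverses_def simp del: mul_assoc)
  ultimately have "x = e \<odot> f" using inverse_unique[OF xc] by blast
  then show ?thesis using xx by simp
qed

lemma (in inverse_sgroup) idem_commute:
  assumes e: "e \<in> carrier T" "e \<odot> e = e" and f: "f \<in> carrier T" "f \<odot> f = f"
  shows "e \<odot> f = f \<odot> e"
proof -
  note [simp] = mul_assoc mul_closed
  have ee: "e \<odot> (e \<odot> z) = e \<odot> z" and ff: "f \<odot> (f \<odot> z) = f \<odot> z" if "z \<in> carrier T" for z
    using that e f by (metis mul_assoc)+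
  have 1: "e \<odot> (f \<odot> (e \<odot> f)) = e \<odot> f" using idem_mul_idem[OF e f] e f by simp
  have 2: "f \<odot> (e \<odot> (f \<odot> e)) = f \<odot> e" using idem_mul_idem[OF f e] e f by simp
  have "e \<odot> f \<in> inverses T (e \<odot> f)" using e f 1 by (simp add: inverses_def)
  moreover have "f \<odot> e \<in> inverses T (e \<odot> f)" using e f 1 2 by (simp add: inverses_def ee ff)
  ultimately show ?thesis using inverse_unique[of "e \<odot> f"] e f by simp
qed

lemma (in inverse_sgroup) idems_lower_semilattice: "lower_semilattice (idems T)"
proof -
  interpret partial_order "idems T"
  proof
    fix x y z assume *: "x \<sqsubseteq>\<^bsub>idems T\<^esub> y" "y \<sqsubseteq>\<^bsub>idems T\<^esub> z"
      "x \<in> carrier (idems T)" "y \<in> carrier (idems T)" "z \<in> carrier (idems T)"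
    then have "x = x \<odot> y" "y = y \<odot> z" "x \<in> carrier T" "y \<in> carrier T" "z \<in> carrier T"
      by (auto simp: idems_def)
    then have "x = x \<odot> z" by (metis mul_assoc)
    then show "x \<sqsubseteq>\<^bsub>idems T\<^esub> z" by (simp add: idems_def)
  next
    fix x y assume *: "x \<sqsubseteq>\<^bsub>idems T\<^esub> y" "y \<sqsubseteq>\<^bsub>idems T\<^esub> x"
      "x \<in> carrier (idems T)" "y \<in> carrier (idems T)"
    then have "x = y" using idem_commute[of x y] by (simp add: idems_def)
    then show "x .=\<^bsub>idems T\<^esub> y" by (simp add: idems_def)
  qed (auto simp: idems_def)
  show ?thesis
  proof
    fix x y assume xy: "x \<in> carrier (idems T)" "y \<in> carrier (idems T)"
    then have x: "x \<in> carrier T" "x \<odot> x = x" and y: "y \<in> carrier T" "y \<odot> y = y"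
      by (auto simp: idems_def)
    have c: "x \<odot> y \<in> carrier T" using x y by (simp add: mul_closed)
    have "greatest (idems T) (x \<odot> y) (Lower (idems T) {x, y})"
    proof (rule greatest_LowerI)
      fix z assume "z \<in> {x, y}"
      moreover have "x \<odot> y = (x \<odot> y) \<odot> y" using x y by (simp add: mul_assoc)
      moreover have "x \<odot> y = (x \<odot> y) \<odot> x"
        using x y idem_commute[OF x y] by (simp add: mul_assoc)
      ultimately show "x \<odot> y \<sqsubseteq>\<^bsub>idems T\<^esub> z" by (auto simp: idems_def)
    next
      fix z assume z: "z \<in> Lower (idems T) {x, y}"
      then have "z = z \<odot> x" "z = z \<odot> y" "z \<in> carrier T"
        using xy by (auto simp: Lower_def idems_def)
      then have "z = z \<odot> (x \<odot> y)" using x y by (metis mul_assoc)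
      then show "z \<sqsubseteq>\<^bsub>idems T\<^esub> (x \<odot> y)" by (simp add: idems_def)
    next
      show "x \<odot> y \<in> carrier (idems T)" using idem_mul_idem[OF x y] c by (simp add: idems_def)
    qed (use xy in simp)
    then show "\<exists>s. greatest (idems T) s (Lower (idems T) {x, y})" ..
  qed
qed

text \<open>The value \<open>restr P e f x\<close> is the restriction of \<open>x\<close> from the fibre over \<open>e\<close> to the
  fibre over \<open>f\<close>; it is only meaningful for \<open>f\<close> below \<open>e\<close>.\<close>

record ('e, 'x) presheaf_data =
  fibre :: "'e \<Rightarrow> 'x set"
  restr :: "'e \<Rightarrow> 'e \<Rightarrow> 'x \<Rightarrow> 'x"

locale presheaf = lower_semilattice E for E :: "'e gorder" (structure) +
  fixes P :: "('e, 'x) presheaf_data"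
  assumes fibre_disjoint:
      "\<lbrakk>e \<in> carrier E; f \<in> carrier E; e \<noteq> f\<rbrakk> \<Longrightarrow> fibre P e \<inter> fibre P f = {}"
    and restr_in:
      "\<lbrakk>e \<in> carrier E; f \<in> carrier E; f \<sqsubseteq> e; x \<in> fibre P e\<rbrakk> \<Longrightarrow> restr P e f x \<in> fibre P f"
    and restr_id:
      "\<lbrakk>e \<in> carrier E; x \<in> fibre P e\<rbrakk> \<Longrightarrow> restr P e e x = x"
    and restr_restr:
      "\<lbrakk>e \<in> carrier E; f \<in> carrier E; g \<in> carrier E; f \<sqsubseteq> e; g \<sqsubseteq> f; x \<in> fibre P e\<rbrakk>
        \<Longrightarrow> restr P f g (restr P e f x) = restr P e g x"

definition global_support :: "'e gorder \<Rightarrow> ('e, 'x) presheaf_data \<Rightarrow> bool"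
  where "global_support E P \<longleftrightarrow> (\<forall>e\<in>carrier E. fibre P e \<noteq> {})"

definition total :: "'e gorder \<Rightarrow> ('e, 'x) presheaf_data \<Rightarrow> 'x set"
  where "total E P = (\<Union>e\<in>carrier E. fibre P e)"

definition proj :: "'e gorder \<Rightarrow> ('e, 'x) presheaf_data \<Rightarrow> 'x \<Rightarrow> 'e"
  where "proj E P x = (THE e. e \<in> carrier E \<and> x \<in> fibre P e)"

definition presheaf_lact :: "'e gorder \<Rightarrow> ('e, 'x) presheaf_data \<Rightarrow> 'e \<Rightarrow> 'x \<Rightarrow> 'x"
  where "presheaf_lact E P e x = restr P (proj E P x) (e \<sqinter>\<^bsub>E\<^esub> proj E P x) x"

definition presheaf_ract :: "'e gorder \<Rightarrow> ('e, 'x) presheaf_data \<Rightarrow> 'x \<Rightarrow> 'e \<Rightarrow> 'x"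
  where "presheaf_ract E P x e = restr P (proj E P x) (e \<sqinter>\<^bsub>E\<^esub> proj E P x) x"

definition yamada ::
  "('t, 'x) presheaf_data \<Rightarrow> 't magma \<Rightarrow> ('t, 'y) presheaf_data \<Rightarrow> ('x \<times> 't \<times> 'y) magma"
  where "yamada X T Y =
    \<lparr>carrier = {(x, t, y). x \<in> total (idems T) X \<and> t \<in> carrier T \<and> y \<in> total (idems T) Y \<and>
        proj (idems T) X x = sran T t \<and> proj (idems T) Y y = sdom T t},
     mul = (\<lambda>(x, s, y) (u, t, v).
       (presheaf_ract (idems T) X x (sran T (s \<odot>\<^bsub>T\<^esub> t)),
        s \<odot>\<^bsub>T\<^esub> t,
        presheaf_lact (idems T) Y (sdom T (s \<odot>\<^bsub>T\<^esub> t)) v))\<rparr>"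

text \<open>Green's relations through the principal one-sided ideals \<open>S\<^sup>1 s\<close> and \<open>s S\<^sup>1\<close>.\<close>

definition green_L :: "'a magma \<Rightarrow> ('a \<times> 'a) set"
  where "green_L S = {(s, t). s \<in> carrier S \<and> t \<in> carrier S \<and>
    insert s {a \<odot>\<^bsub>S\<^esub> s | a. a \<in> carrier S} = insert t {a \<odot>\<^bsub>S\<^esub> t | a. a \<in> carrier S}}"

definition green_R :: "'a magma \<Rightarrow> ('a \<times> 'a) set"
  where "green_R S = {(s, t). s \<in> carrier S \<and> t \<in> carrier S \<and>
    insert s {s \<odot>\<^bsub>S\<^esub> a | a. a \<in> carrier S} = insert t {t \<odot>\<^bsub>S\<^esub> a | a. a \<in> carrier S}}"

text \<open>On a generalized inverse semigroup this is the minimum inverse congruence.\<close>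

definition gam :: "'a magma \<Rightarrow> ('a \<times> 'a) set"
  where "gam S = {(s, t). s \<in> carrier S \<and> t \<in> carrier S \<and> inverses S s \<inter> inverses S t \<noteq> {}}"

definition lam :: "'a magma \<Rightarrow> ('a \<times> 'a) set"
  where "lam S = gam S \<inter> green_L S"

definition rho :: "'a magma \<Rightarrow> ('a \<times> 'a) set"
  where "rho S = gam S \<inter> green_R S"

text \<open>Operations on classes are unions over all representatives (the convention of
  \<open>HOL.Equiv_Relations\<close>): when the operation is well defined, the union is the class
  obtained from any choice of representatives.\<close>

definition quot_sgroup :: "'a magma \<Rightarrow> ('a \<times> 'a) set \<Rightarrow> 'a set magma"
  where "quot_sgroup S r = \<lparr>carrier = carrier S // r,
    mul = (\<lambda>A B. \<Union>a\<in>A. \<Union>b\<in>B. r `` {a \<odot>\<^bsub>S\<^esub> b})\<rparr>"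

definition S_R :: "'a magma \<Rightarrow> 'a set set"
  where "S_R S = carrier S // lam S"

definition S_L :: "'a magma \<Rightarrow> 'a set set"
  where "S_L S = carrier S // rho S"

definition S_R_act :: "'a magma \<Rightarrow> 'a set \<Rightarrow> 'a set \<Rightarrow> 'a set"
  where "S_R_act S A B = (\<Union>a\<in>A. \<Union>s\<in>B. lam S `` {a \<odot>\<^bsub>S\<^esub> s})"

definition S_L_act :: "'a magma \<Rightarrow> 'a set \<Rightarrow> 'a set \<Rightarrow> 'a set"
  where "S_L_act S B A = (\<Union>s\<in>B. \<Union>a\<in>A. rho S `` {s \<odot>\<^bsub>S\<^esub> a})"

definition pairing :: "'a magma \<Rightarrow> 'a set \<Rightarrow> 'a set \<Rightarrow> 'a set"
  where "pairing S B C = (\<Union>s\<in>B. \<Union>t\<in>C. gam S `` {s \<odot>\<^bsub>S\<^esub> t})"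

text \<open>Here \<open>Q\<close> is a right \<open>R\<close>-set with action \<open>ra\<close>, and \<open>P\<close> a left \<open>R\<close>-set with action
  \<open>la\<close>.\<close>

definition tensor_gen ::
  "'r magma \<Rightarrow> 'q set \<Rightarrow> ('q \<Rightarrow> 'r \<Rightarrow> 'q) \<Rightarrow> 'p set \<Rightarrow> ('r \<Rightarrow> 'p \<Rightarrow> 'p) \<Rightarrow> (('q \<times> 'p) \<times> ('q \<times> 'p)) set"
  where "tensor_gen R Q ra P la =
    {((ra q r, p), (q, la r p)) | q r p. q \<in> Q \<and> r \<in> carrier R \<and> p \<in> P}"

text \<open>The equivalence relation on \<open>Q \<times> P\<close> generated by \<^const>\<open>tensor_gen\<close>: the
  intersection cuts the reflexive part of the closure down to \<open>Q \<times> P\<close>.\<close>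

definition tensor_rel ::
  "'r magma \<Rightarrow> 'q set \<Rightarrow> ('q \<Rightarrow> 'r \<Rightarrow> 'q) \<Rightarrow> 'p set \<Rightarrow> ('r \<Rightarrow> 'p \<Rightarrow> 'p) \<Rightarrow> (('q \<times> 'p) \<times> ('q \<times> 'p)) set"
  where "tensor_rel R Q ra P la =
    (tensor_gen R Q ra P la \<union> (tensor_gen R Q ra P la)\<inverse>)\<^sup>* \<inter> (Q \<times> P) \<times> (Q \<times> P)"

definition morita ::
  "'r magma \<Rightarrow> 'q set \<Rightarrow> ('q \<Rightarrow> 'r \<Rightarrow> 'q) \<Rightarrow> 'p set \<Rightarrow> ('r \<Rightarrow> 'p \<Rightarrow> 'p) \<Rightarrow> ('p \<Rightarrow> 'q \<Rightarrow> 'r)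
    \<Rightarrow> ('q \<times> 'p) set magma"
  where "morita R Q ra P la br =
    \<lparr>carrier = (Q \<times> P) // tensor_rel R Q ra P la,
     mul = (\<lambda>A B. \<Union>(q, p)\<in>A. \<Union>(q', p')\<in>B.
       tensor_rel R Q ra P la `` {(q, la (br p q') p')})\<rparr>"

definition morita_sgroup :: "'a magma \<Rightarrow> ('a set \<times> 'a set) set magma"
  where "morita_sgroup S =
    morita (quot_sgroup S (gam S)) (S_L S) (S_L_act S) (S_R S) (S_R_act S) (pairing S)"

end

theory Submission
  imports Defs
begin

text \<open>The isomorphism \<open>S\<^sub>L \<otimes> S\<^sub>R \<rightarrow> S\<close> is multiplication: \<open>\<rho>(a) \<otimes> \<lambda>(b) \<mapsto> ab\<close>. It is well defined
  because in \<open>S = \<Y>(X,T,Y)\<close> the classes \<open>\<rho>(x,t,y)\<close> and \<open>\<lambda>(x,t,y)\<close> amount to the pairs \<open>(x,t)\<close> and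
  \<open>(t,y)\<close>, which determine products with \<open>(x,t,y)\<close> as left, respectively right, factor. It is
  surjective by regularity. For injectivity let \<open>c = ab\<close>, let \<open>b'\<close> and \<open>c'\<close> be inverses of \<open>b\<close>
  and \<open>c\<close>, and compute
  \<open>\<rho>(a) \<otimes> \<lambda>(b) = \<rho>(a) \<otimes> \<lambda>(bb'b) = \<rho>(ab) \<otimes> \<lambda>(b'b) = \<rho>(cc'c) \<otimes> \<lambda>(b'b) = \<rho>(c) \<otimes> \<lambda>(c'cb'b) = \<rho>(c) \<otimes> \<lambda>(c'c)\<close>,
  which depends on \<open>ab\<close> only.\<close>

section \<open>Green's relations as equivalences\<close>

lemma equiv_kernel: "equiv A {(s, t). s \<in> A \<and> t \<in> A \<and> f s = f t}"
  by (rule equivI) (auto simp: refl_on_def sym_def trans_def)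

lemma equiv_green_L: "equiv (carrier S) (green_L S)"
  unfolding green_L_def by (rule equiv_kernel)

lemma equiv_green_R: "equiv (carrier S) (green_R S)"
  unfolding green_R_def by (rule equiv_kernel)

text \<open>Divisibility in both directions makes the principal left ideals of \<open>s\<close> and
  \<open>t\<close> contain each other.\<close>

lemma green_LI:
  fixes S :: "'a magma" (structure)
  assumes "sgroup S"
    and "s \<in> carrier S" "t \<in> carrier S" "c \<in> carrier S" "d \<in> carrier S" "c \<odot> t = s" "d \<odot> s = t"
  shows "(s, t) \<in> green_L S"
proof -
  interpret sgroup S by fact
  \<comment> \<open>One inclusion of principal ideals, stated for arbitrary \<open>s\<close>,
    \<open>t\<close>, \<open>c\<close> so that it serves both directions.\<close>
  have le: "insert s {a \<odot> s | a. a \<in> carrier S} \<subseteq> insert t {a \<odot> t | a. a \<in> carrier S}"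
    if "t \<in> carrier S" "c \<in> carrier S" "c \<odot> t = s" for s t c
    using that mul_assoc[of _ c t] mul_closed by auto metis
  show ?thesis unfolding green_L_def using assms le[of t c s] le[of s d t] by auto
qed

lemma green_RI:
  fixes S :: "'a magma" (structure)
  assumes "sgroup S"
    and "s \<in> carrier S" "t \<in> carrier S" "c \<in> carrier S" "d \<in> carrier S" "t \<odot> c = s" "s \<odot> d = t"
  shows "(s, t) \<in> green_R S"
proof -
  interpret sgroup S by fact
  have le: "insert s {s \<odot> a | a. a \<in> carrier S} \<subseteq> insert t {t \<odot> a | a. a \<in> carrier S}"
    if "t \<in> carrier S" "c \<in> carrier S" "t \<odot> c = s" for s t c
    using that mul_assoc[of t c] mul_closed by auto
  show ?thesis unfolding green_R_def using assms le[of t c s] le[of s d t] by auto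
qed

lemma equiv_Int:
  assumes "equiv A r" "equiv A s"
  shows "equiv A (r \<inter> s)"
  using assms unfolding equiv_def refl_on_def sym_def trans_def by blast

text \<open>Collects what the isomorphism needs to know about a Yamada semigroup, without mention of
  triples. The decisive condition is \<open>rho_lam_mul\<close>, which turns multiplication into a
  map on pairs in \<open>S_L S \<times> S_R S\<close>; \<open>lam_mul\<close> and
  \<open>rho_mul\<close> make the two actions well defined, and \<open>gam_mul\<close> the
  pairing.\<close>

locale class_factor_sgroup = sgroup S for S :: "'a magma" (structure) +
  assumes regular: "a \<in> carrier S \<Longrightarrow> \<exists>b\<in>carrier S. a \<odot> b \<odot> a = a"
    and equiv_gam: "equiv (carrier S) (gam S)"
    and gam_mul: "\<lbrakk>(a, a') \<in> gam S; (b, b') \<in> gam S\<rbrakk> \<Longrightarrow> (a \<odot> b, a' \<odot> b') \<in> gam S"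
    and lam_mul: "\<lbrakk>(a, a') \<in> gam S; (b, b') \<in> lam S\<rbrakk> \<Longrightarrow> (a \<odot> b, a' \<odot> b') \<in> lam S"
    and rho_mul: "\<lbrakk>(a, a') \<in> rho S; (b, b') \<in> gam S\<rbrakk> \<Longrightarrow> (a \<odot> b, a' \<odot> b') \<in> rho S"
    and rho_lam_mul: "\<lbrakk>(a, a') \<in> rho S; (b, b') \<in> lam S\<rbrakk> \<Longrightarrow> a \<odot> b = a' \<odot> b'"
begin

abbreviation G where "G a \<equiv> gam S `` {a}"
abbreviation L where "L a \<equiv> lam S `` {a}"
abbreviation R where "R a \<equiv> rho S `` {a}"

definition tensor_eq :: "(('a set \<times> 'a set) \<times> 'a set \<times> 'a set) set"
  where "tensor_eq = tensor_rel (quot_sgroup S (gam S)) (S_L S) (S_L_act S) (S_R S) (S_R_act S)"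

text \<open>The tensor that multiplication sends to \<open>a\<close>, as a set of pairs of classes: the inverse of
  the isomorphism, defined without choosing a factorization of \<open>a\<close>.\<close>

definition factorizations :: "'a \<Rightarrow> ('a set \<times> 'a set) set"
  where "factorizations a = {(R b, L c) | b c. b \<in> carrier S \<and> c \<in> carrier S \<and> b \<odot> c = a}"

section \<open>Classes, the two actions and the pairing\<close>

lemma equiv_lam: "equiv (carrier S) (lam S)"
  unfolding lam_def by (rule equiv_Int[OF equiv_gam equiv_green_L])

lemma equiv_rho: "equiv (carrier S) (rho S)"
  unfolding rho_def by (rule equiv_Int[OF equiv_gam equiv_green_R])

lemma lam_gam: "(a, b) \<in> lam S \<Longrightarrow> (a, b) \<in> gam S"
  by (simp add: lam_def)

lemma rho_gam: "(a, b) \<in> rho S \<Longrightarrow> (a, b) \<in> gam S"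
  by (simp add: rho_def)

lemma R_eq_iff: "\<lbrakk>a \<in> carrier S; b \<in> carrier S\<rbrakk> \<Longrightarrow> R a = R b \<longleftrightarrow> (a, b) \<in> rho S"
  using eq_equiv_class_iff[OF equiv_rho] .

lemma L_eq_iff: "\<lbrakk>a \<in> carrier S; b \<in> carrier S\<rbrakk> \<Longrightarrow> L a = L b \<longleftrightarrow> (a, b) \<in> lam S"
  using eq_equiv_class_iff[OF equiv_lam] .

text \<open>By \<open>lam_mul\<close> all classes in the defining union coincide, so any
  representatives compute the action. The right action and the pairing are treated alike.\<close>

lemma S_R_act_class:
  assumes "a \<in> carrier S" "b \<in> carrier S"
  shows "S_R_act S (G a) (L b) = L (a \<odot> b)"
proof -
  have "congruent2 (gam S) (lam S) (\<lambda>a b. L (a \<odot> b))"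
    by (auto intro!: congruent2I' equiv_class_eq[OF equiv_lam] lam_mul)
  then show ?thesis
    unfolding S_R_act_def by (rule UN_equiv_class2[OF equiv_gam equiv_lam _ assms])
qed

lemma S_L_act_class:
  assumes "a \<in> carrier S" "b \<in> carrier S"
  shows "S_L_act S (R a) (G b) = R (a \<odot> b)"
proof -
  have "congruent2 (rho S) (gam S) (\<lambda>a b. R (a \<odot> b))"
    by (auto intro!: congruent2I' equiv_class_eq[OF equiv_rho] rho_mul)
  then show ?thesis
    unfolding S_L_act_def by (rule UN_equiv_class2[OF equiv_rho equiv_gam _ assms])
qed

lemma pairing_class:
  assumes "a \<in> carrier S" "b \<in> carrier S"
  shows "pairing S (L a) (R b) = G (a \<odot> b)"
proof -
  have "congruent2 (lam S) (rho S) (\<lambda>a b. G (a \<odot> b))"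
    by (auto intro!: congruent2I' equiv_class_eq[OF equiv_gam] gam_mul dest: lam_gam rho_gam)
  then show ?thesis
    unfolding pairing_def by (rule UN_equiv_class2[OF equiv_lam equiv_rho _ assms])
qed

section \<open>The tensor product as the set of products\<close>

text \<open>In terms of representatives, a generating pair moves the middle factor of
  \<open>a c b\<close> across the tensor sign, so associativity alone will show that both sides have
  the same product.\<close>

lemma tensor_gen_iff:
  "z \<in> tensor_gen (quot_sgroup S (gam S)) (S_L S) (S_L_act S) (S_R S) (S_R_act S) \<longleftrightarrow>
    (\<exists>a\<in>carrier S. \<exists>c\<in>carrier S. \<exists>b\<in>carrier S. z = ((R (a \<odot> c), L b), (R a, L (c \<odot> b))))"
    (is "z \<in> ?gen \<longleftrightarrow> ?rhs")
proof
  assume "z \<in> ?gen"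
  then obtain q r p where z: "z = ((S_L_act S q r, p), (q, S_R_act S r p))"
    and q: "q \<in> S_L S" and r: "r \<in> carrier S // gam S" and p: "p \<in> S_R S"
    by (auto simp: tensor_gen_def quot_sgroup_def)
  obtain a where a: "a \<in> carrier S" "q = R a" using q by (auto simp: S_L_def elim: quotientE)
  obtain b where b: "b \<in> carrier S" "p = L b" using p by (auto simp: S_R_def elim: quotientE)
  obtain c where c: "c \<in> carrier S" "r = G c" using r by (auto elim: quotientE)
  have "z = ((R (a \<odot> c), L b), (R a, L (c \<odot> b)))"
    using z a b c by (simp add: S_L_act_class S_R_act_class)
  then show ?rhs using a b c by blast
next
  assume ?rhs
  then obtain a b c where abc: "a \<in> carrier S" "b \<in> carrier S" "c \<in> carrier S"
    and z: "z = ((R (a \<odot> c), L b), (R a, L (c \<odot> b)))" by blast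
  have "R a \<in> S_L S" "G c \<in> carrier S // gam S" "L b \<in> S_R S"
    using abc by (auto simp: S_L_def S_R_def intro: quotientI)
  moreover have "z = ((S_L_act S (R a) (G c), L b), (R a, S_R_act S (G c) (L b)))"
    using z abc by (simp add: S_L_act_class S_R_act_class)
  ultimately show "z \<in> ?gen" unfolding tensor_gen_def quot_sgroup_def by auto
qed

lemma tensor_eq_mul:
  assumes abc: "a \<in> carrier S" "b \<in> carrier S" "c \<in> carrier S"
  shows "((R (a \<odot> c), L b), (R a, L (c \<odot> b))) \<in> tensor_eq"
proof -
  have "((R (a \<odot> c), L b), (R a, L (c \<odot> b)))
      \<in> tensor_gen (quot_sgroup S (gam S)) (S_L S) (S_L_act S) (S_R S) (S_R_act S)"
    unfolding tensor_gen_iff using abc by blast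
  then show ?thesis
    using abc mul_closed
    by (auto simp: tensor_eq_def tensor_rel_def S_L_def S_R_def intro!: quotientI)
qed

lemma equiv_tensor_eq: "equiv (S_L S \<times> S_R S) tensor_eq"
proof (rule equivI)
  let ?g = "tensor_gen (quot_sgroup S (gam S)) (S_L S) (S_L_act S) (S_R S) (S_R_act S)"
  have "sym ((?g \<union> ?g\<inverse>)\<^sup>*)" by (intro sym_rtrancl sym_Un_converse)
  then show "sym tensor_eq"
    unfolding tensor_eq_def tensor_rel_def sym_def by blast
  show "trans tensor_eq"
    unfolding tensor_eq_def tensor_rel_def by (rule transI) (blast intro: rtrancl_trans)
  show "refl_on (S_L S \<times> S_R S) tensor_eq"
    unfolding tensor_eq_def tensor_rel_def by (rule refl_onI) auto
  show "tensor_eq \<subseteq> (S_L S \<times> S_R S) \<times> (S_L S \<times> S_R S)"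
    unfolding tensor_eq_def tensor_rel_def by blast
qed

text \<open>A generating step in either direction preserves membership in
  \<open>factorizations e\<close>; hence a chain starting at a factorization of \<open>a b\<close>
  only meets factorizations of \<open>a b\<close>.\<close>

lemma tensor_eq_imp_mul_eq:
  assumes "((R a, L b), (R c, L d)) \<in> tensor_eq"
    and "a \<in> carrier S" "b \<in> carrier S" "c \<in> carrier S" "d \<in> carrier S"
  shows "a \<odot> b = c \<odot> d"
proof -
  let ?g = "tensor_gen (quot_sgroup S (gam S)) (S_L S) (S_L_act S) (S_R S) (S_R_act S)"
  \<comment> \<open>By \<open>rho_lam_mul\<close>, membership can be tested on any
    representatives.\<close>
  have fact: "(R b, L c) \<in> factorizations a \<longleftrightarrow> b \<odot> c = a"
    if "b \<in> carrier S" "c \<in> carrier S" for a b c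
    unfolding factorizations_def using that
    by (auto simp: R_eq_iff L_eq_iff dest: rho_lam_mul)
  have step: "w \<in> factorizations e \<Longrightarrow> z \<in> factorizations e" if "(w, z) \<in> ?g \<union> ?g\<inverse>" for w z e
    using that unfolding Un_iff converse_iff tensor_gen_iff
    by (auto simp: fact mul_closed mul_assoc)
  have "((R a, L b), (R c, L d)) \<in> (?g \<union> ?g\<inverse>)\<^sup>*"
    using assms(1) unfolding tensor_eq_def tensor_rel_def by blast
  then have "(R c, L d) \<in> factorizations (a \<odot> b)"
    by (induction rule: rtrancl_induct) (use fact step assms in auto)
  then show ?thesis using fact assms by simp
qed

text \<open>Supplies a normal form: for fixed \<open>c'\<close> the right-hand pair involves
  \<open>a\<close> and \<open>b\<close> only through their product.\<close>

lemma tensor_eq_canonical: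
  assumes "a \<in> carrier S" "b \<in> carrier S" "c' \<in> carrier S" "a \<odot> b \<odot> c' \<odot> (a \<odot> b) = a \<odot> b"
  shows "((R a, L b), (R (a \<odot> b), L (c' \<odot> (a \<odot> b)))) \<in> tensor_eq"
proof -
  note eqv = equiv_tensor_eq
  have tr: "\<lbrakk>(u, v) \<in> tensor_eq; (v, w) \<in> tensor_eq\<rbrakk> \<Longrightarrow> (u, w) \<in> tensor_eq" for u v w
    using eqv by (meson equivE transD)
  have sy: "(u, v) \<in> tensor_eq \<Longrightarrow> (v, u) \<in> tensor_eq" for u v
    using eqv by (meson equivE symD)
  obtain b' where b': "b' \<in> carrier S" "b \<odot> b' \<odot> b = b" using regular assms by blast
  let ?c = "a \<odot> b"
  have c: "?c \<in> carrier S" using assms mul_closed by blast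
  have bb: "b \<odot> (b' \<odot> b) = b" and "c' \<odot> ?c \<odot> (b' \<odot> b) = c' \<odot> ?c"
    using b' assms by (simp_all add: mul_assoc mul_closed)
  moreover have "?c \<odot> (c' \<odot> ?c) = ?c"
    using assms c by (simp add: mul_assoc mul_closed)
  \<comment> \<open>Read from right to left: \<open>b\<close> is written as \<open>b (b' b)\<close>
    and its leading factor moves to the left.\<close>
  moreover have "((R ?c, L (b' \<odot> b)), (R a, L (b \<odot> (b' \<odot> b)))) \<in> tensor_eq"
    using assms b' by (intro tensor_eq_mul mul_closed)
  \<comment> \<open>Now \<open>c' (a b)\<close> moves to the right, where it absorbs
    \<open>b' b\<close>.\<close>
  moreover have "((R (?c \<odot> (c' \<odot> ?c)), L (b' \<odot> b)), (R ?c, L (c' \<odot> ?c \<odot> (b' \<odot> b)))) \<in> tensor_eq"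
    using assms b' by (intro tensor_eq_mul mul_closed)
  ultimately show ?thesis using tr sy by metis
qed

lemma tensor_eq_iff:
  assumes "a \<in> carrier S" "b \<in> carrier S" "c \<in> carrier S" "d \<in> carrier S"
  shows "((R a, L b), (R c, L d)) \<in> tensor_eq \<longleftrightarrow> a \<odot> b = c \<odot> d"
proof
  assume eq: "a \<odot> b = c \<odot> d"
  \<comment> \<open>The same \<open>e\<close> serves both tensors, so they share one normal
    form.\<close>
  obtain e where e: "e \<in> carrier S" "a \<odot> b \<odot> e \<odot> (a \<odot> b) = a \<odot> b"
    using regular mul_closed assms by blast
  have "((R a, L b), (R (a \<odot> b), L (e \<odot> (a \<odot> b)))) \<in> tensor_eq"
    using tensor_eq_canonical assms e by blast
  moreover have "((R c, L d), (R (a \<odot> b), L (e \<odot> (a \<odot> b)))) \<in> tensor_eq"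
    unfolding eq using tensor_eq_canonical[of c d e] assms e by (simp add: eq)
  ultimately show "((R a, L b), (R c, L d)) \<in> tensor_eq"
    using equiv_tensor_eq by (meson equivE symD transD)
qed (use tensor_eq_imp_mul_eq assms in blast)

text \<open>Every member of a tensor class is a pair of classes with representatives, so
  \<open>tensor_eq_iff\<close> decides membership and the class depends on \<open>a b\<close>
  alone.\<close>

lemma tensor_class:
  assumes "a \<in> carrier S" "b \<in> carrier S"
  shows "tensor_eq `` {(R a, L b)} = factorizations (a \<odot> b)"
proof
  show "factorizations (a \<odot> b) \<subseteq> tensor_eq `` {(R a, L b)}"
    using assms by (auto simp: factorizations_def tensor_eq_iff)
  show "tensor_eq `` {(R a, L b)} \<subseteq> factorizations (a \<odot> b)"
  proof
    fix z assume z: "z \<in> tensor_eq `` {(R a, L b)}"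
    then have "z \<in> S_L S \<times> S_R S" unfolding tensor_eq_def tensor_rel_def by blast
    then obtain c d where cd: "c \<in> carrier S" "d \<in> carrier S" "z = (R c, L d)"
      by (auto simp: S_L_def S_R_def elim!: quotientE)
    then show "z \<in> factorizations (a \<odot> b)"
      using z assms by (auto simp: factorizations_def tensor_eq_iff)
  qed
qed

section \<open>The Morita semigroup\<close>

text \<open>Regularity gives \<open>a = (a b) a\<close>; hence multiplication reaches every
  element.\<close>

lemma factor:
  assumes "a \<in> carrier S"
  obtains b c where "b \<in> carrier S" "c \<in> carrier S" "b \<odot> c = a"
  using regular[OF assms] assms mul_closed by metis

lemma carrier_morita: "carrier (morita_sgroup S) = factorizations ` carrier S"
proof -
  have "carrier (morita_sgroup S) = (S_L S \<times> S_R S) // tensor_eq"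
    by (simp add: morita_sgroup_def morita_def tensor_eq_def)
  also have "\<dots> = {tensor_eq `` {(R b, L c)} | b c. b \<in> carrier S \<and> c \<in> carrier S}"
    by (auto simp: S_L_def S_R_def quotient_def)
  also have "\<dots> = {factorizations (b \<odot> c) | b c. b \<in> carrier S \<and> c \<in> carrier S}"
    using tensor_class by blast
  also have "\<dots> = factorizations ` carrier S"
    by (auto simp: mul_closed) (metis factor)
  finally show ?thesis .
qed

text \<open>The product of \<open>a1 \<otimes> a2\<close> and \<open>b1 \<otimes> b2\<close> is
  \<open>a1 \<otimes> (a2 b1) b2\<close>, whose factors multiply to \<open>a b\<close>.\<close>

lemma mul_morita:
  assumes a: "a \<in> carrier S" and b: "b \<in> carrier S"
  shows "factorizations a \<odot>\<^bsub>morita_sgroup S\<^esub> factorizations b = factorizations (a \<odot> b)"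
proof -
  have "tensor_eq `` {(q, S_R_act S (pairing S p q') p')} = factorizations (a \<odot> b)"
    if "(q, p) \<in> factorizations a" "(q', p') \<in> factorizations b" for q p q' p'
  proof -
    obtain a1 a2 where a12: "a1 \<in> carrier S" "a2 \<in> carrier S" "a1 \<odot> a2 = a" "q = R a1" "p = L a2"
      using \<open>(q, p) \<in> factorizations a\<close> by (auto simp: factorizations_def)
    obtain b1 b2 where b12: "b1 \<in> carrier S" "b2 \<in> carrier S" "b1 \<odot> b2 = b" "q' = R b1" "p' = L b2"
      using \<open>(q', p') \<in> factorizations b\<close> by (auto simp: factorizations_def)
    have "a1 \<odot> (a2 \<odot> b1 \<odot> b2) = a \<odot> b"
      using a12(1-3) b12(1-3) by (metis mul_assoc mul_closed)
    then show ?thesis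
      using a12 b12 by (simp add: pairing_class S_R_act_class tensor_class mul_closed)
  qed
  \<comment> \<open>The union defining the product has constant value; it equals that value because
    its index sets are non-empty.\<close>
  moreover have "factorizations c \<noteq> {}" if c: "c \<in> carrier S" for c
  proof -
    obtain d e where "d \<in> carrier S" "e \<in> carrier S" "d \<odot> e = c" using factor[OF c] .
    then have "(R d, L e) \<in> factorizations c" unfolding factorizations_def by blast
    then show ?thesis by blast
  qed
  then have "factorizations a \<noteq> {}" "factorizations b \<noteq> {}" using a b by blast+
  ultimately show ?thesis
    unfolding morita_sgroup_def morita_def tensor_eq_def[symmetric] by fastforce
qed

text \<open>Two equal sets of factorizations share a pair of classes, and \<open>rho_lam_mul\<close>
  recovers the product from that pair.\<close>

lemma inj_on_factorizations: "inj_on factorizations (carrier S)"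
proof (rule inj_onI)
  fix a b assume a: "a \<in> carrier S" and b: "b \<in> carrier S"
    and eq: "factorizations a = factorizations b"
  obtain c d where cd: "c \<in> carrier S" "d \<in> carrier S" "c \<odot> d = a" using factor[OF a] .
  then have "(R c, L d) \<in> factorizations a" unfolding factorizations_def by blast
  then have "(R c, L d) \<in> factorizations b" by (simp only: eq)
  then obtain c' d' where "c' \<in> carrier S" "d' \<in> carrier S" "c' \<odot> d' = b" "R c = R c'" "L d = L d'"
    by (auto simp: factorizations_def)
  then show "a = b" using cd by (metis R_eq_iff L_eq_iff rho_lam_mul)
qed

theorem isomorphic_morita: "sgroup_isomorphic S (morita_sgroup S)"
proof -
  \<comment> \<open>Closure and associativity transfer from \<open>S\<close>, since every element
    has the form \<open>factorizations a\<close>.\<close>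
  have "sgroup (morita_sgroup S)"
    by (rule sgroup.intro) (auto simp: carrier_morita mul_morita mul_closed mul_assoc)
  moreover have "bij_betw factorizations (carrier S) (carrier (morita_sgroup S))"
    by (simp add: bij_betw_def inj_on_factorizations carrier_morita)
  ultimately show ?thesis
    unfolding sgroup_isomorphic_def using sgroup_axioms mul_morita by metis
qed

end

section \<open>Inverses, domains and ranges in an inverse semigroup\<close>

context inverse_sgroup
begin

lemma sinv_inverses: "s \<in> carrier T \<Longrightarrow> sinv T s \<in> inverses T s"
  unfolding sinv_def by (rule theI') (rule unique_inverse)

lemma sinv_closed: "s \<in> carrier T \<Longrightarrow> sinv T s \<in> carrier T"
  and mul_sinv_mul: "s \<in> carrier T \<Longrightarrow> s \<odot> sinv T s \<odot> s = s"
  and sinv_mul_sinv: "s \<in> carrier T \<Longrightarrow> sinv T s \<odot> s \<odot> sinv T s = sinv T s"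
  using sinv_inverses[of s] by (auto simp: inverses_def)

lemma sran_idem: "s \<in> carrier T \<Longrightarrow> sran T s \<in> carrier (idems T)"
  by (simp add: sran_def idems_def mul_closed sinv_closed mul_assoc[symmetric] mul_sinv_mul)

lemma sdom_idem: "s \<in> carrier T \<Longrightarrow> sdom T s \<in> carrier (idems T)"
  by (simp add: sdom_def idems_def mul_closed sinv_closed mul_assoc[symmetric] sinv_mul_sinv)

lemma sran_mul_le:
  assumes "s \<in> carrier T" "t \<in> carrier T"
  shows "sran T (s \<odot> t) \<sqsubseteq>\<^bsub>idems T\<^esub> sran T s"
proof -
  have "sran T s \<odot> sran T (s \<odot> t) = (s \<odot> sinv T s \<odot> s) \<odot> (t \<odot> sinv T (s \<odot> t))"
    using assms by (simp add: sran_def mul_assoc mul_closed sinv_closed)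
  also have "\<dots> = sran T (s \<odot> t)"
    using assms by (simp add: mul_sinv_mul) (simp add: sran_def mul_assoc mul_closed sinv_closed)
  finally show ?thesis
    \<comment> \<open>The order on \<open>idems T\<close> is absorption on the right, so the two
      idempotents must be swapped.\<close>
    using idem_commute[of "sran T s" "sran T (s \<odot> t)"] sran_idem assms
    by (simp add: idems_def mul_closed)
qed

lemma sdom_mul_le:
  assumes "s \<in> carrier T" "t \<in> carrier T"
  shows "sdom T (s \<odot> t) \<sqsubseteq>\<^bsub>idems T\<^esub> sdom T t"
proof -
  have "sdom T (s \<odot> t) \<odot> sdom T t = sinv T (s \<odot> t) \<odot> s \<odot> (t \<odot> sinv T t \<odot> t)"
    using assms by (simp add: sdom_def mul_assoc mul_closed sinv_closed)
  also have "\<dots> = sdom T (s \<odot> t)"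
    using assms by (simp add: mul_sinv_mul) (simp add: sdom_def mul_assoc mul_closed sinv_closed)
  finally show ?thesis by (simp add: idems_def)
qed

end

section \<open>Fibres and restrictions of a presheaf\<close>

context presheaf
begin

lemma proj_eq: "\<lbrakk>e \<in> carrier E; x \<in> fibre P e\<rbrakk> \<Longrightarrow> proj E P x = e"
  unfolding proj_def using fibre_disjoint by (intro the_equality) blast+

lemma total_proj_iff:
  "e \<in> carrier E \<Longrightarrow> x \<in> total E P \<and> proj E P x = e \<longleftrightarrow> x \<in> fibre P e"
  unfolding total_def using proj_eq by auto

lemma meet_below:
  "\<lbrakk>e \<in> carrier E; f \<in> carrier E; f \<sqsubseteq> e\<rbrakk> \<Longrightarrow> f \<sqinter> e = f"
  by (intro le_antisym meet_left meet_le meet_closed) simp_all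

text \<open>A Yamada product acts only by idempotents below the index of the fibre, where the meet
  is the idempotent itself and the action is a plain restriction.\<close>

lemma lact_below:
  "\<lbrakk>e \<in> carrier E; f \<in> carrier E; f \<sqsubseteq> e; x \<in> fibre P e\<rbrakk> \<Longrightarrow> presheaf_lact E P f x = restr P e f x"
  unfolding presheaf_lact_def by (simp add: proj_eq meet_below)

lemma ract_below:
  "\<lbrakk>e \<in> carrier E; f \<in> carrier E; f \<sqsubseteq> e; x \<in> fibre P e\<rbrakk> \<Longrightarrow> presheaf_ract E P x f = restr P e f x"
  unfolding presheaf_ract_def by (simp add: proj_eq meet_below)

end

section \<open>Yamada semigroups in coordinates\<close>

locale yamada_sgroup = inverse_sgroup T + X: presheaf "idems T" X + Y: presheaf "idems T" Y
  for T :: "'t magma" (structure) and X :: "('t, 'x) presheaf_data" and Y :: "('t, 'y) presheaf_data" +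
  assumes supportX: "global_support (idems T) X" and supportY: "global_support (idems T) Y"
begin

abbreviation S where "S \<equiv> yamada X T Y"

lemma carrier_iff:
  "(x, t, y) \<in> carrier S \<longleftrightarrow> t \<in> carrier T \<and> x \<in> fibre X (sran T t) \<and> y \<in> fibre Y (sdom T t)"
  using X.total_proj_iff[of "sran T t" x] Y.total_proj_iff[of "sdom T t" y]
  by (auto simp: yamada_def sran_idem sdom_idem)

lemma mul_eq:
  assumes "(x, s, y) \<in> carrier S" "(u, t, v) \<in> carrier S"
  shows "(x, s, y) \<odot>\<^bsub>S\<^esub> (u, t, v) =
    (restr X (sran T s) (sran T (s \<odot> t)) x, s \<odot> t, restr Y (sdom T t) (sdom T (s \<odot> t)) v)"
  using assms
  by (simp add: carrier_iff)
    (simp add: yamada_def X.ract_below Y.lact_below sran_idem sdom_idem sran_mul_le sdom_mul_le mul_closed)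

sublocale S: sgroup S
proof (rule sgroup.intro)
  show closed: "a \<odot>\<^bsub>S\<^esub> b \<in> carrier S" if "a \<in> carrier S" "b \<in> carrier S" for a b
    using that
    by (cases a; cases b)
      (simp add: mul_eq, simp add: carrier_iff X.restr_in Y.restr_in sran_idem sdom_idem
        sran_mul_le sdom_mul_le mul_closed)
  show "(a \<odot>\<^bsub>S\<^esub> b) \<odot>\<^bsub>S\<^esub> c = a \<odot>\<^bsub>S\<^esub> (b \<odot>\<^bsub>S\<^esub> c)"
    if abc: "a \<in> carrier S" "b \<in> carrier S" "c \<in> carrier S" for a b c
  proof -
    obtain x s y u t v w r z where eq: "a = (x, s, y)" "b = (u, t, v)" "c = (w, r, z)"
      by (metis prod_cases3)
    have T: "s \<in> carrier T" "t \<in> carrier T" "r \<in> carrier T"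
      and xz: "x \<in> fibre X (sran T s)" "z \<in> fibre Y (sdom T r)"
      using abc eq by (auto simp: carrier_iff)
    \<comment> \<open>Lets the two successive restrictions of \<open>x\<close> compose. With
      products nested to the right this bound is not an instance of \<open>sran_mul_le\<close>,
      whereas its counterpart for \<open>z\<close> is one of \<open>sdom_mul_le\<close>.\<close>
    have "sran T (s \<odot> (t \<odot> r)) \<sqsubseteq>\<^bsub>idems T\<^esub> sran T (s \<odot> t)"
      using sran_mul_le[of "s \<odot> t" r] T by (simp add: mul_assoc mul_closed)
    then show ?thesis
      using closed[OF abc(1,2)] closed[OF abc(2,3)] abc T xz unfolding eq
      by (simp add: mul_eq)
        (simp add: mul_assoc mul_closed X.restr_restr Y.restr_restr sran_idem sdom_idem
          sran_mul_le sdom_mul_le)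
  qed
qed

text \<open>As \<open>s t s = s\<close>, the restrictions of \<open>x\<close> compose to one from
  \<open>sran T s\<close> to itself, and \<open>y'\<close> is restricted from
  \<open>sdom T s\<close> to itself. This yields inverses in \<open>S\<close> and multipliers for
  Green's relations.\<close>

lemma sandwich:
  assumes "(x, s, y) \<in> carrier S" "(u, t, v) \<in> carrier S" "(x', s, y') \<in> carrier S" "s \<odot> t \<odot> s = s"
  shows "(x, s, y) \<odot>\<^bsub>S\<^esub> (u, t, v) \<odot>\<^bsub>S\<^esub> (x', s, y') = (x, s, y')"
proof -
  have T: "s \<in> carrier T" "t \<in> carrier T" and xy: "x \<in> fibre X (sran T s)" "y' \<in> fibre Y (sdom T s)"
    using assms by (auto simp: carrier_iff)
  have "sran T s \<sqsubseteq>\<^bsub>idems T\<^esub> sran T (s \<odot> t)"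
    using sran_mul_le[of "s \<odot> t" s] T assms(4) by (simp add: mul_closed)
  then show ?thesis
    using S.mul_closed[OF assms(1,2)] assms T xy
    by (simp add: mul_eq)
      (simp add: mul_closed X.restr_restr X.restr_id Y.restr_id sran_idem sdom_idem sran_mul_le)
qed

lemma mid_mul:
  "\<lbrakk>a \<in> carrier S; b \<in> carrier S\<rbrakk> \<Longrightarrow> fst (snd (a \<odot>\<^bsub>S\<^esub> b)) = fst (snd a) \<odot> fst (snd b)"
  by (cases a; cases b) (simp add: mul_eq)

text \<open>Projection to the middle coordinate is a homomorphism, which gives one direction;
  \<open>sandwich\<close> gives the other.\<close>

lemma inverses_iff:
  assumes "(x, s, y) \<in> carrier S"
  shows "(u, t, v) \<in> inverses S (x, s, y) \<longleftrightarrow> (u, t, v) \<in> carrier S \<and> t \<in> inverses T s"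
proof
  assume inv: "(u, t, v) \<in> inverses S (x, s, y)"
  then have b: "(u, t, v) \<in> carrier S" by (simp add: inverses_def)
  have "(x, s, y) \<odot>\<^bsub>S\<^esub> (u, t, v) \<odot>\<^bsub>S\<^esub> (x, s, y) = (x, s, y)"
    "(u, t, v) \<odot>\<^bsub>S\<^esub> (x, s, y) \<odot>\<^bsub>S\<^esub> (u, t, v) = (u, t, v)"
    using inv by (simp_all add: inverses_def)
  from this[THEN arg_cong[where f = "fst \<circ> snd"]] have "s \<odot> t \<odot> s = s" "t \<odot> s \<odot> t = t"
    using assms b by (simp_all add: mid_mul S.mul_closed)
  then show "(u, t, v) \<in> carrier S \<and> t \<in> inverses T s"
    using b by (simp add: inverses_def carrier_iff)
next
  assume "(u, t, v) \<in> carrier S \<and> t \<in> inverses T s"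
  then show "(u, t, v) \<in> inverses S (x, s, y)"
    using assms sandwich[of x s y u t v x y] sandwich[of u t v x s y u v] by (auto simp: inverses_def)
qed

text \<open>Global support provides the outer coordinates over the range and domain of
  \<open>sinv T s\<close>.\<close>

lemma inverse_exists:
  assumes "(x, s, y) \<in> carrier S"
  obtains u v where "(u, sinv T s, v) \<in> inverses S (x, s, y)"
proof -
  have s: "s \<in> carrier T" using assms by (simp add: carrier_iff)
  obtain u v where "u \<in> fibre X (sran T (sinv T s))" "v \<in> fibre Y (sdom T (sinv T s))"
    using supportX supportY sran_idem sdom_idem sinv_closed[OF s]
    unfolding global_support_def by blast
  then show thesis
    using that assms s by (simp add: inverses_iff carrier_iff sinv_closed sinv_inverses)
qed

text \<open>A common inverse has a middle coordinate \<open>r\<close> inverse to both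
  \<open>s\<close> and \<open>t\<close>; these are then inverses of \<open>r\<close>, hence equal.
  Conversely, an inverse of one triple is an inverse of every triple with the same middle
  coordinate.\<close>

lemma gam_iff:
  assumes a: "(x, s, y) \<in> carrier S" and b: "(u, t, v) \<in> carrier S"
  shows "((x, s, y), (u, t, v)) \<in> gam S \<longleftrightarrow> s = t"
proof
  assume "((x, s, y), (u, t, v)) \<in> gam S"
  then obtain c where "c \<in> inverses S (x, s, y)" "c \<in> inverses S (u, t, v)"
    by (auto simp: gam_def)
  then obtain r where "r \<in> inverses T s" "r \<in> inverses T t"
    using a b by (cases c) (auto simp: inverses_iff)
  then have "r \<in> carrier T" "s \<in> inverses T r" "t \<in> inverses T r"
    using a b by (auto simp: inverses_def carrier_iff)
  then show "s = t" using inverse_unique by blast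
next
  assume "s = t"
  obtain u' v' where c: "(u', sinv T s, v') \<in> inverses S (x, s, y)" using inverse_exists[OF a] .
  then have "(u', sinv T s, v') \<in> inverses S (u, t, v)"
    using a b \<open>s = t\<close> by (simp add: inverses_iff)
  with c show "((x, s, y), (u, t, v)) \<in> gam S" using a b by (auto simp: gam_def)
qed

text \<open>Both multipliers come from bracketing
  \<open>(x, s, y) (p, sinv T s, q) (u, s, v)\<close>, which equals \<open>(x, s, v)\<close> by
  \<open>sandwich\<close>.\<close>

lemma mul_absorb:
  assumes "(x, s, y) \<in> carrier S" "(u, s, v) \<in> carrier S"
  shows "\<exists>c\<in>carrier S. c \<odot>\<^bsub>S\<^esub> (u, s, v) = (x, s, v)"
    and "\<exists>d\<in>carrier S. (x, s, y) \<odot>\<^bsub>S\<^esub> d = (x, s, v)"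
proof -
  obtain p q where "(p, sinv T s, q) \<in> inverses S (x, s, y)" using inverse_exists[OF assms(1)] .
  then have i: "(p, sinv T s, q) \<in> carrier S" by (simp add: inverses_def)
  have "(x, s, y) \<odot>\<^bsub>S\<^esub> (p, sinv T s, q) \<odot>\<^bsub>S\<^esub> (u, s, v) = (x, s, v)"
    using sandwich[OF assms(1) i assms(2)] assms(1) by (simp add: carrier_iff mul_sinv_mul)
  then show "\<exists>c\<in>carrier S. c \<odot>\<^bsub>S\<^esub> (u, s, v) = (x, s, v)"
    and "\<exists>d\<in>carrier S. (x, s, y) \<odot>\<^bsub>S\<^esub> d = (x, s, v)"
    using S.mul_closed[OF assms(1) i] S.mul_closed[OF i assms(2)] S.mul_assoc[OF assms(1) i assms(2)]
    by (blast, metis)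
qed

text \<open>A left multiple with unchanged middle coordinate keeps its last coordinate, since that
  is restricted from \<open>sdom T t\<close> to itself. Conversely, \<open>mul_absorb\<close> gives
  multipliers both ways.\<close>

lemma lam_iff:
  assumes a: "(x, s, y) \<in> carrier S" and b: "(u, t, v) \<in> carrier S"
  shows "((x, s, y), (u, t, v)) \<in> lam S \<longleftrightarrow> s = t \<and> y = v"
proof
  assume lam: "((x, s, y), (u, t, v)) \<in> lam S"
  then have st: "s = t" using gam_iff[OF a b] by (simp add: lam_def)
  have "y = v" if eq: "(x, s, y) = c \<odot>\<^bsub>S\<^esub> (u, t, v)" "c \<in> carrier S" for c
    using eq st b by (cases c) (auto simp: mul_eq carrier_iff Y.restr_id sdom_idem)
  moreover have "(x, s, y) = (u, t, v) \<or> (\<exists>c\<in>carrier S. (x, s, y) = c \<odot>\<^bsub>S\<^esub> (u, t, v))"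
    using lam unfolding lam_def green_L_def by blast
  ultimately show "s = t \<and> y = v" using st by auto
next
  assume eq: "s = t \<and> y = v"
  obtain c where "c \<in> carrier S" "c \<odot>\<^bsub>S\<^esub> (u, t, v) = (x, s, y)"
    using mul_absorb(1)[of x s y u v] a b
    unfolding conjunct1[OF eq] conjunct2[OF eq] by blast
  moreover obtain d where "d \<in> carrier S" "d \<odot>\<^bsub>S\<^esub> (x, s, y) = (u, t, v)"
    using mul_absorb(1)[of u s v x y] a b
    unfolding conjunct1[OF eq] conjunct2[OF eq] by blast
  ultimately have "((x, s, y), (u, t, v)) \<in> green_L S" using green_LI[OF S.sgroup_axioms] a b by metis
  then show "((x, s, y), (u, t, v)) \<in> lam S" using gam_iff[OF a b] eq by (simp add: lam_def)
qed

lemma rho_iff: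
  assumes a: "(x, s, y) \<in> carrier S" and b: "(u, t, v) \<in> carrier S"
  shows "((x, s, y), (u, t, v)) \<in> rho S \<longleftrightarrow> s = t \<and> x = u"
proof
  assume rho: "((x, s, y), (u, t, v)) \<in> rho S"
  then have st: "s = t" using gam_iff[OF a b] by (simp add: rho_def)
  have "x = u" if eq: "(x, s, y) = (u, t, v) \<odot>\<^bsub>S\<^esub> c" "c \<in> carrier S" for c
    using eq st b by (cases c) (auto simp: mul_eq carrier_iff X.restr_id sran_idem)
  moreover have "(x, s, y) = (u, t, v) \<or> (\<exists>c\<in>carrier S. (x, s, y) = (u, t, v) \<odot>\<^bsub>S\<^esub> c)"
    using rho unfolding rho_def green_R_def by blast
  ultimately show "s = t \<and> x = u" using st by auto
next
  assume eq: "s = t \<and> x = u"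
  obtain c where "c \<in> carrier S" "(u, t, v) \<odot>\<^bsub>S\<^esub> c = (x, s, y)"
    using mul_absorb(2)[of u s v x y] a b
    unfolding conjunct1[OF eq] conjunct2[OF eq] by blast
  moreover obtain d where "d \<in> carrier S" "(x, s, y) \<odot>\<^bsub>S\<^esub> d = (u, t, v)"
    using mul_absorb(2)[of x s y u v] a b
    unfolding conjunct1[OF eq] conjunct2[OF eq] by blast
  ultimately have "((x, s, y), (u, t, v)) \<in> green_R S" using green_RI[OF S.sgroup_axioms] a b by metis
  then show "((x, s, y), (u, t, v)) \<in> rho S" using gam_iff[OF a b] eq by (simp add: rho_def)
qed

lemma gam_cases:
  assumes "(a, b) \<in> gam S"
  obtains x s y u v where "a = (x, s, y)" "b = (u, s, v)" "(x, s, y) \<in> carrier S" "(u, s, v) \<in> carrier S"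
proof -
  have "a \<in> carrier S" "b \<in> carrier S" using assms by (auto simp: gam_def)
  then show thesis using assms that by (cases a; cases b) (auto simp: gam_iff)
qed

lemma lam_cases:
  assumes "(a, b) \<in> lam S"
  obtains x s y u where "a = (x, s, y)" "b = (u, s, y)" "(x, s, y) \<in> carrier S" "(u, s, y) \<in> carrier S"
proof -
  have "a \<in> carrier S" "b \<in> carrier S" using assms by (auto simp: lam_def gam_def)
  then show thesis using assms that by (cases a; cases b) (auto simp: lam_iff)
qed

lemma rho_cases:
  assumes "(a, b) \<in> rho S"
  obtains x s y v where "a = (x, s, y)" "b = (x, s, v)" "(x, s, y) \<in> carrier S" "(x, s, v) \<in> carrier S"
proof -
  have "a \<in> carrier S" "b \<in> carrier S" using assms by (auto simp: rho_def gam_def)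
  then show thesis using assms that by (cases a; cases b) (auto simp: rho_iff)
qed

text \<open>Besides the middle coordinates, the first coordinate of a product depends only on that
  of the left factor, and the last only on that of the right factor. With the coordinate forms of
  the three relations, all compatibility conditions follow.\<close>

sublocale S: class_factor_sgroup S
proof unfold_locales
  show "\<exists>b\<in>carrier S. a \<odot>\<^bsub>S\<^esub> b \<odot>\<^bsub>S\<^esub> a = a" if c: "a \<in> carrier S" for a
  proof -
    obtain x s y where a: "a = (x, s, y)" by (cases a)
    obtain u v where "(u, sinv T s, v) \<in> inverses S a"
      using inverse_exists c unfolding a by blast
    then show ?thesis unfolding inverses_def by force
  qed
  show "equiv (carrier S) (gam S)"
  proof (rule equivI)
    show "gam S \<subseteq> carrier S \<times> carrier S" by (auto simp: gam_def)
    show "refl_on (carrier S) (gam S)" by (rule refl_onI) (auto simp: gam_iff)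
    show "sym (gam S)" by (rule symI) (auto simp: gam_def)
    show "trans (gam S)" by (rule transI) (auto elim!: gam_cases simp: gam_iff)
  qed
  show "(a \<odot>\<^bsub>S\<^esub> b, a' \<odot>\<^bsub>S\<^esub> b') \<in> gam S" if ab: "(a, a') \<in> gam S" "(b, b') \<in> gam S" for a a' b b'
  proof -
    have "a \<in> carrier S" "a' \<in> carrier S" "b \<in> carrier S" "b' \<in> carrier S"
      using ab by (auto simp: gam_def)
    note S.mul_closed[OF this(1,3)] S.mul_closed[OF this(2,4)]
    then show ?thesis using ab by (auto elim!: gam_cases simp: mul_eq gam_iff)
  qed
  show "(a \<odot>\<^bsub>S\<^esub> b, a' \<odot>\<^bsub>S\<^esub> b') \<in> lam S" if ab: "(a, a') \<in> gam S" "(b, b') \<in> lam S" for a a' b b'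
  proof -
    have "a \<in> carrier S" "a' \<in> carrier S" "b \<in> carrier S" "b' \<in> carrier S"
      using ab by (auto simp: gam_def lam_def)
    note S.mul_closed[OF this(1,3)] S.mul_closed[OF this(2,4)]
    then show ?thesis using ab by (auto elim!: gam_cases lam_cases simp: mul_eq lam_iff)
  qed
  show "(a \<odot>\<^bsub>S\<^esub> b, a' \<odot>\<^bsub>S\<^esub> b') \<in> rho S" if ab: "(a, a') \<in> rho S" "(b, b') \<in> gam S" for a a' b b'
  proof -
    have "a \<in> carrier S" "a' \<in> carrier S" "b \<in> carrier S" "b' \<in> carrier S"
      using ab by (auto simp: gam_def rho_def)
    note S.mul_closed[OF this(1,3)] S.mul_closed[OF this(2,4)]
    then show ?thesis using ab by (auto elim!: gam_cases rho_cases simp: mul_eq rho_iff)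
  qed
  show "a \<odot>\<^bsub>S\<^esub> b = a' \<odot>\<^bsub>S\<^esub> b'" if "(a, a') \<in> rho S" "(b, b') \<in> lam S" for a a' b b'
    using that by (auto elim!: lam_cases rho_cases simp: mul_eq)
qed

end

theorem theorem5p1:
  fixes T :: "'t magma"
    and X :: "('t, 'x) presheaf_data"
    and Y :: "('t, 'y) presheaf_data"
    and S :: "('x \<times> 't \<times> 'y) magma"
  assumes "inverse_sgroup T"
    and "presheaf (idems T) X" and "global_support (idems T) X"
    and "presheaf (idems T) Y" and "global_support (idems T) Y"
    and "S = yamada X T Y"
  shows "sgroup_isomorphic S (morita_sgroup S)"
proof -
  interpret yamada_sgroup T X Y
    using assms(1-5) by (intro yamada_sgroup.intro yamada_sgroup_axioms.intro)
  show ?thesis unfolding assms(6) by (rule S.isomorphic_morita)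
qed

end
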